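(* Let $(a_n)_{n\geq 1}$ be a non-constant monotone decreasing (i.e. $a_{n+1}\leq a_n$ for all $n\geq 1$) sequence of positive real numbers with $a_1=1$, and define $\ell=\min\{k\geq 1: a_k<1\}$. Let $F$ be the function defined in the open unit disk $D(0,1)=\{z\in\mathbb{C}:|z|<1\}$ by $$F(z)=1-(1-z)\exp\left(\sum_{n=1}^\infty\frac{a_n}{n}z^n\right),$$ and let $\sum_{n=1}^\infty c_nz^n$ be the power series expansion of $F$ in the neighbourhood of $0$. Then: (a) For every $n\geq 1$ we have $c_n\in[0,1)$, and $\sum_{n=1}^\infty c_n\leq 1$. (b) $F$ can be continuously extended to the closed unit disk $\overline{D(0,1)}$. (c) For $1\leq n<\ell$ we have $c_n=0$, and for $n\geq \ell$ we have $c_n>0$. (d) For every $z\in\overline{D(0,1)}\setminus\{0,1\}$ we have $|F(z)|<|z|^\ell$, where $F$ also denotes the continuous extension from (b).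
   Context: "Monotone decreasing" is meant in the weak sense: consecutive terms may be equal (for instance $1=a_1=\dots=a_{\ell-1}>a_\ell$). *)

theory Defs
  imports "HOL-Complex_Analysis.Complex_Analysis"
begin

text \<open>
  A sequence indexed from 1 is a function on \<^typ>\<open>nat\<close> whose value at 0 is irrelevant; its series
  are shifted by \<^const>\<open>Suc\<close> accordingly.
\<close>

definition F :: "(nat \<Rightarrow> real) \<Rightarrow> complex \<Rightarrow> complex" where
  "F a z = 1 - (1 - z) * exp (\<Sum>n. complex_of_real (a (Suc n)) / of_nat (Suc n) * z ^ Suc n)"

definition c :: "(nat \<Rightarrow> real) \<Rightarrow> nat \<Rightarrow> complex" where
  "c a n = fps_nth (fps_expansion (F a) 0) n"

definition first_below_one :: "(nat \<Rightarrow> real) \<Rightarrow> nat" where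
  "first_below_one a = (LEAST k. k \<ge> 1 \<and> a k < 1)"

text \<open>
  The definitions above use total operators (infinite sum, higher derivatives, \<open>LEAST\<close>); the
  following facts show that they are meaningful for the sequences under consideration.
\<close>

context
  fixes a :: "nat \<Rightarrow> real"
  assumes a1: "a 1 = 1"
    and decr: "\<And>n. n \<ge> 1 \<Longrightarrow> a (Suc n) \<le> a n"
    and pos: "\<And>n. n \<ge> 1 \<Longrightarrow> a n > 0"
begin

lemma a_le_1: "a (Suc n) \<le> 1"
proof (induction n)
  case 0
  show ?case using a1 by simp
next
  case (Suc n)
  then show ?case using decr[of "Suc n"] by simp
qed

lemma first_below_one_props:
  assumes "\<not> a constant_on {1..}"
  shows "first_below_one a \<ge> 1" "a (first_below_one a) < 1"
proof -
  have "\<exists>k. k \<ge> 1 \<and> a k < 1"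
  proof (rule ccontr)
    assume *: "\<not> ?thesis"
    have "a k = 1" if "k \<in> {1..}" for k
      using * a_le_1[of "k - 1"] that by (auto simp: not_less intro: antisym)
    with assms show False unfolding constant_on_def by blast
  qed
  from LeastI_ex[OF this] show "first_below_one a \<ge> 1" "a (first_below_one a) < 1"
    unfolding first_below_one_def by blast+
qed

lemma exponent_summable:
  assumes "norm z < 1"
  shows "summable (\<lambda>n. complex_of_real (a (Suc n)) / of_nat (Suc n) * z ^ Suc n)"
proof (rule summable_comparison_test')
  show "summable (\<lambda>n. norm z ^ Suc n)"
    using assms by (subst summable_Suc_iff) (auto intro: summable_geometric)
next
  fix n :: nat
  have "\<bar>a (Suc n)\<bar> / real (Suc n) \<le> 1"
    using a_le_1[of n] pos[of "Suc n"] by (simp add: field_simps)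
  then have "\<bar>a (Suc n)\<bar> / real (Suc n) * norm z ^ Suc n \<le> 1 * norm z ^ Suc n"
    by (intro mult_right_mono) auto
  then show "norm (complex_of_real (a (Suc n)) / of_nat (Suc n) * z ^ Suc n) \<le> norm z ^ Suc n"
    by (simp only: norm_mult norm_divide norm_power norm_of_real norm_of_nat mult_1)
qed

lemma F_holomorphic: "F a holomorphic_on ball 0 1"
proof -
  define f where "f n = (if n = 0 then 0 else complex_of_real (a n) / of_nat n)" for n
  define s where "s z = (\<Sum>n. complex_of_real (a (Suc n)) / of_nat (Suc n) * z ^ Suc n)" for z
  have "s holomorphic_on ball 0 1"
  proof (rule power_series_holomorphic[where a = f])
    fix w :: complex
    assume "w \<in> ball 0 1"
    then have "(\<lambda>n. f (Suc n) * w ^ Suc n) sums s w"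
      using summable_sums[OF exponent_summable[of w]] by (simp add: f_def s_def)
    then show "(\<lambda>n. f n * (w - 0) ^ n) sums s w"
      by (subst (asm) sums_Suc_iff) (simp add: f_def)
  qed
  then show ?thesis
    unfolding F_def[abs_def] s_def by (intro holomorphic_intros)
qed

lemma F_power_series:
  assumes "norm z < 1"
  shows "(\<lambda>n. c a (Suc n) * z ^ Suc n) sums F a z"
proof -
  have c0: "c a 0 = 0"
    by (simp add: c_def fps_expansion_def F_def)
  have "(\<lambda>n. c a n * z ^ n) sums F a z"
    using holomorphic_power_series[OF F_holomorphic, of z] assms
    by (simp add: c_def fps_expansion_def)
  then show ?thesis
    by (subst sums_Suc_iff) (simp add: c0)
qed

end

end

theory Submission
  imports Defs
begin

text \<open>
  Put \<open>H = 1 - F\<close> and \<open>b\<^sub>n = 1 - a\<^sub>n\<close>. Since \<open>1 - z = exp (- \<Sum> z\<^sup>n / n)\<close>, we have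
  \<open>H = exp (- \<Sum> b\<^sub>n z\<^sup>n / n)\<close>, so \<open>z H' = - H \<cdot> \<Sum> b\<^sub>n z\<^sup>n\<close> and \<open>n c\<^sub>n = b\<^sub>n - \<Sum>\<^sub>k\<^sub><\<^sub>n c\<^sub>k b\<^sub>n\<^sub>-\<^sub>k\<close>.
  On the other hand \<open>H / (1 - z) = exp (\<Sum> a\<^sub>n z\<^sup>n / n)\<close> has positive coefficients, and these are
  the numbers \<open>1 - (c\<^sub>1 + \<dots> + c\<^sub>n)\<close>. As \<open>b\<close> is increasing, induction gives
  \<open>n c\<^sub>n \<ge> b\<^sub>n (1 - (c\<^sub>1 + \<dots> + c\<^sub>n\<^sub>-\<^sub>1)) \<ge> 0\<close>, which yields (a) and (c). Hence the power series converges
  absolutely on the closed disk, and (d) follows from the triangle inequality, which is strict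
  already for the two terms of index \<open>\<ell>\<close> and \<open>\<ell> + 1\<close>.
\<close>

section \<open>Coefficients of formal exponentials\<close>

text \<open>Comparison of coefficients in \<open>E' = E * A'\<close> for \<open>E = exp A\<close>.
  The recursion determines every coefficient of \<open>E\<close> from the earlier ones.\<close>

lemma fps_exp_compose_nth_Suc:
  fixes A :: "'a::field_char_0 fps"
  assumes "fps_nth A 0 = 0"
  shows "of_nat (Suc n) * fps_nth (fps_exp 1 oo A) (Suc n) =
    (\<Sum>i=0..n. fps_nth (fps_exp 1 oo A) i * (of_nat (Suc (n - i)) * fps_nth A (Suc (n - i))))"
proof -
  have "fps_deriv (fps_exp 1 oo A) = (fps_exp 1 oo A) * fps_deriv A"
    using fps_compose_deriv[OF assms, of "fps_exp 1"] by simp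
  then have "fps_nth (fps_deriv (fps_exp 1 oo A)) n = fps_nth ((fps_exp 1 oo A) * fps_deriv A) n"
    by simp
  then show ?thesis
    by (simp add: fps_mult_nth)
qed

text \<open>Both sides obey the same recursion and start with 1. This moves the arguments about
  signs and order to real series.\<close>

lemma fps_exp_compose_of_real:
  fixes A :: "real fps"
  assumes "fps_nth A 0 = 0"
  shows "fps_nth (fps_exp (1::complex) oo Abs_fps (\<lambda>n. of_real (fps_nth A n))) n =
    of_real (fps_nth (fps_exp 1 oo A) n)"
proof (induction n rule: less_induct)
  case (less n)
  let ?A = "Abs_fps (\<lambda>n. complex_of_real (fps_nth A n))"
  show ?case
  proof (cases n)
    case 0
    then show ?thesis by simp
  next
    case (Suc m)
    have "of_nat (Suc m) * fps_nth (fps_exp (1::complex) oo ?A) (Suc m) =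
        (\<Sum>i=0..m. of_real (fps_nth (fps_exp 1 oo A) i) *
          (of_nat (Suc (m - i)) * of_real (fps_nth A (Suc (m - i)))))"
      using fps_exp_compose_nth_Suc[of ?A m] assms less.IH Suc by simp
    also have "\<dots> = of_real (of_nat (Suc m) * fps_nth (fps_exp 1 oo A) (Suc m))"
      unfolding fps_exp_compose_nth_Suc[OF assms] by simp
    finally show ?thesis
      using Suc by (simp del: of_nat_Suc)
  qed
qed

section \<open>The formal power series of \<open>1 - F\<close>\<close>

text \<open>The constant coefficient is 0 because \<open>a 0 / 0 = 0\<close>.\<close>

definition exponent_fps :: "(nat \<Rightarrow> real) \<Rightarrow> real fps" where
  "exponent_fps a = Abs_fps (\<lambda>n. a n / real n)"

definition H_fps :: "(nat \<Rightarrow> real) \<Rightarrow> real fps" where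
  "H_fps a = (1 - fps_X) * (fps_exp 1 oo exponent_fps a)"

lemma exponent_fps_nth_0 [simp]: "fps_nth (exponent_fps a) 0 = 0"
  by (simp add: exponent_fps_def)

lemma one_minus_fps_X_mult_ones: "(1 - fps_X) * Abs_fps (\<lambda>n. 1) = (1 :: real fps)"
proof -
  have "inverse (Abs_fps (\<lambda>n. 1)) * Abs_fps (\<lambda>n. 1) = (1 :: real fps)"
    by (rule inverse_mult_eq_1) simp
  then show ?thesis by (simp add: fps_inverse_gp')
qed

lemma H_fps_nth_0 [simp]: "fps_nth (H_fps a) 0 = 1"
  by (simp add: H_fps_def)

text \<open>Multiplication by \<open>1 / (1 - X)\<close> turns coefficients into partial sums, and
  it cancels the factor \<open>1 - X\<close> of \<open>H_fps a\<close>.\<close>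

lemma sum_H_fps_nth:
  "(\<Sum>i=0..n. fps_nth (H_fps a) i) = fps_nth (fps_exp 1 oo exponent_fps a) n"
proof -
  have "H_fps a * Abs_fps (\<lambda>n. 1) = ((1 - fps_X) * Abs_fps (\<lambda>n. 1)) * (fps_exp 1 oo exponent_fps a)"
    by (simp add: H_fps_def mult_ac)
  then have "H_fps a * Abs_fps (\<lambda>n. 1) = (fps_exp 1 oo exponent_fps a)"
    by (simp only: one_minus_fps_X_mult_ones mult_1)
  then have "fps_nth (H_fps a * Abs_fps (\<lambda>n. 1)) n = fps_nth (fps_exp 1 oo exponent_fps a) n"
    by simp
  then show ?thesis
    by (simp add: fps_mult_nth)
qed

text \<open>The logarithmic derivative of \<open>1 - X\<close> is \<open>- 1 / (1 - X)\<close>,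
  whose coefficients are all -1; the exponential factor contributes the coefficients
  \<open>a (Suc n)\<close>.\<close>

lemma fps_deriv_H_fps:
  "fps_deriv (H_fps a) = - (H_fps a * Abs_fps (\<lambda>n. 1 - a (Suc n)))"
proof -
  let ?E = "fps_exp 1 oo exponent_fps a" and ?A = "Abs_fps (\<lambda>n. a (Suc n))"
  have A: "fps_deriv (exponent_fps a) = ?A"
    by (simp add: fps_eq_iff exponent_fps_def del: of_nat_Suc)
  have B: "Abs_fps (\<lambda>n. 1 - a (Suc n)) = Abs_fps (\<lambda>n. 1) - ?A"
    by (simp add: fps_eq_iff)
  have E': "fps_deriv ?E = ?E * ?A"
    using fps_compose_deriv[of "exponent_fps a" "fps_exp 1"] A by simp
  have "fps_deriv (H_fps a) = (1 - fps_X) * (?E * ?A) - ?E"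
    by (simp add: H_fps_def E')
  also have "\<dots> = (1 - fps_X) * (?E * ?A) - ((1 - fps_X) * Abs_fps (\<lambda>n. 1)) * ?E"
    by (simp only: one_minus_fps_X_mult_ones mult_1)
  also have "\<dots> = - (H_fps a * (Abs_fps (\<lambda>n. 1) - ?A))"
    by (simp add: H_fps_def algebra_simps)
  finally show ?thesis by (simp only: B)
qed

lemma H_fps_nth_Suc:
  "real (Suc n) * - fps_nth (H_fps a) (Suc n) =
    (\<Sum>i=0..n. fps_nth (H_fps a) i * (1 - a (Suc (n - i))))"
proof -
  have "fps_nth (fps_deriv (H_fps a)) n = - fps_nth (H_fps a * Abs_fps (\<lambda>n. 1 - a (Suc n))) n"
    by (simp add: fps_deriv_H_fps)
  then show ?thesis
    by (simp add: fps_mult_nth)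
qed

text \<open>The constant coefficient is 1, and the recursion for the exponential has only positive
  summands.\<close>

lemma fps_exp_exponent_pos:
  assumes "\<And>n. n \<ge> 1 \<Longrightarrow> a n > 0"
  shows "fps_nth (fps_exp 1 oo exponent_fps a) n > 0"
proof (induction n rule: less_induct)
  case (less n)
  show ?case
  proof (cases n)
    case (Suc m)
    have "real (Suc m) * fps_nth (fps_exp 1 oo exponent_fps a) (Suc m) > 0"
      unfolding fps_exp_compose_nth_Suc[OF exponent_fps_nth_0]
      using less.IH Suc assms by (intro sum_pos) (auto simp: exponent_fps_def)
    then show ?thesis
      using Suc by (simp add: zero_less_mult_iff)
  qed simp
qed

section \<open>Signs and bounds of the coefficients\<close>

context
  fixes a :: "nat \<Rightarrow> real"
  assumes a1: "a 1 = 1"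
    and decr: "\<And>n. n \<ge> 1 \<Longrightarrow> a (Suc n) \<le> a n"
    and pos: "\<And>n. n \<ge> 1 \<Longrightarrow> a n > 0"
begin

lemma a_antimono: "1 \<le> m \<Longrightarrow> m \<le> n \<Longrightarrow> a n \<le> a m"
proof (induction n)
  case (Suc n)
  then show ?case using decr[of n] by (cases "m = Suc n") auto
qed simp

lemma a_eq_1: "1 \<le> n \<Longrightarrow> n < first_below_one a \<Longrightarrow> a n = 1"
  using not_less_Least[of n "\<lambda>k. k \<ge> 1 \<and> a k < 1"] a_antimono[of 1 n] a1
  by (auto simp: first_below_one_def not_less)

text \<open>The lower bound makes the coefficients strictly negative once \<open>a\<close> has
  dropped below 1; the upper bound makes them vanish as long as \<open>a\<close> equals 1.\<close>

lemma H_fps_nth_bounds: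
  "(1 - a (Suc n)) * fps_nth (fps_exp 1 oo exponent_fps a) n
     \<le> real (Suc n) * - fps_nth (H_fps a) (Suc n)"
  "real (Suc n) * - fps_nth (H_fps a) (Suc n) \<le> 1 - a (Suc n)"
  "fps_nth (H_fps a) (Suc n) \<le> 0"
proof -
  let ?h = "fps_nth (H_fps a)"
  let ?E = "fps_nth (fps_exp 1 oo exponent_fps a)"
  have le_1: "a (Suc k) \<le> 1" for k
    using a_le_1[OF a1 decr pos] by blast
  \<comment> \<open>The signs of the earlier coefficients are a hypothesis here, so that this bound
    can serve as the induction step for \<open>neg\<close> below.\<close>
  have lower: "(1 - a (Suc n)) * ?E n \<le> real (Suc n) * - ?h (Suc n)"
    if neg: "\<And>i. i < n \<Longrightarrow> ?h (Suc i) \<le> 0" for n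
  proof -
    have "(1 - a (Suc n)) * ?E n = (\<Sum>i=0..n. ?h i * (1 - a (Suc n)))"
      by (simp add: sum_H_fps_nth[symmetric] sum_distrib_left mult.commute)
    \<comment> \<open>For \<open>i = 0\<close> the two summands agree. For \<open>i > 0\<close> the
      coefficient is nonpositive, so the larger factor \<open>1 - a (Suc n)\<close> gives the
      smaller product.\<close>
    also have "\<dots> \<le> (\<Sum>i=0..n. ?h i * (1 - a (Suc (n - i))))"
    proof (rule sum_mono)
      fix i assume "i \<in> {0..n}"
      show "?h i * (1 - a (Suc n)) \<le> ?h i * (1 - a (Suc (n - i)))"
      proof (cases i)
        case (Suc k)
        then have "?h i \<le> 0" using neg[of k] \<open>i \<in> {0..n}\<close> by simp
        moreover have "a (Suc n) \<le> a (Suc (n - i))" by (rule a_antimono) auto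
        ultimately show ?thesis by (intro mult_left_mono_neg) auto
      qed simp
    qed
    finally show ?thesis by (simp only: H_fps_nth_Suc)
  qed
  have neg: "?h (Suc n) \<le> 0" for n
  proof (induction n rule: less_induct)
    case (less n)
    have "0 \<le> (1 - a (Suc n)) * ?E n"
      using le_1 fps_exp_exponent_pos[of a n] pos by (intro mult_nonneg_nonneg) (auto simp: less_imp_le)
    also have "\<dots> \<le> real (Suc n) * - ?h (Suc n)"
      using less by (rule lower)
    finally show ?case by (simp add: mult_le_0_iff)
  qed
  show "(1 - a (Suc n)) * ?E n \<le> real (Suc n) * - ?h (Suc n)" "?h (Suc n) \<le> 0"
    using lower neg by blast+
  \<comment> \<open>The summand \<open>i = 0\<close> is split off; the constant coefficient is 1,
    and all other summands are nonpositive.\<close>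
  have "real (Suc n) * - ?h (Suc n) =
      (1 - a (Suc n)) + (\<Sum>i=Suc 0..n. ?h i * (1 - a (Suc (n - i))))"
    unfolding H_fps_nth_Suc by (simp add: sum.atLeast_Suc_atMost)
  also have "(\<Sum>i=Suc 0..n. ?h i * (1 - a (Suc (n - i)))) \<le> 0"
  proof (rule sum_nonpos)
    fix i assume "i \<in> {Suc 0..n}"
    then have "?h i \<le> 0" using neg[of "i - 1"] by simp
    then show "?h i * (1 - a (Suc (n - i))) \<le> 0"
      using le_1[of "n - i"] by (simp add: mult_le_0_iff)
  qed
  finally show "real (Suc n) * - ?h (Suc n) \<le> 1 - a (Suc n)" by simp
qed

lemma H_fps_nth_eq_0: "1 \<le> n \<Longrightarrow> n < first_below_one a \<Longrightarrow> fps_nth (H_fps a) n = 0"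
  using H_fps_nth_bounds(2,3)[of "n - 1"] a_eq_1[of n] 
  by (auto simp: zero_le_mult_iff intro!: antisym)

lemma H_fps_nth_neg:
  assumes "\<not> a constant_on {1..}" "first_below_one a \<le> n"
  shows "fps_nth (H_fps a) n < 0"
proof -
  note l = first_below_one_props[OF a1 decr pos assms(1)]
  obtain m where m: "n = Suc m" using l(1) assms(2) by (cases n) auto
  have "a n < 1"
    using a_antimono[OF l(1) assms(2)] l(2) by simp
  then have "0 < (1 - a (Suc m)) * fps_nth (fps_exp 1 oo exponent_fps a) m"
    using m fps_exp_exponent_pos[of a m] pos by simp
  also have "\<dots> \<le> real (Suc m) * - fps_nth (H_fps a) (Suc m)"
    by (rule H_fps_nth_bounds)
  finally show ?thesis using m by (simp add: mult_less_0_iff)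
qed

text \<open>The partial sums of all coefficients, including the leading 1, are coefficients of the
  exponential and hence positive.\<close>

lemma sum_H_fps_nth_Suc_less: "(\<Sum>k\<le>n. - fps_nth (H_fps a) (Suc k)) < 1"
proof -
  have "0 < (\<Sum>i=0..Suc n. fps_nth (H_fps a) i)"
    unfolding sum_H_fps_nth using pos by (rule fps_exp_exponent_pos)
  also have "\<dots> = 1 + (\<Sum>k\<le>n. fps_nth (H_fps a) (Suc k))"
    unfolding atLeast0AtMost by (subst sum.atMost_Suc_shift) simp
  finally show ?thesis by (simp add: sum_negf)
qed

text \<open>Link between the analytic function and the formal series: the expansion of the exponent
  at 0 is composed with that of \<open>exp\<close>.\<close>

lemma c_eq_H_fps:
  assumes "n \<ge> 1"
  shows "c a n = of_real (- fps_nth (H_fps a) n)"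
proof -
  let ?A = "Abs_fps (\<lambda>n. complex_of_real (fps_nth (exponent_fps a) n))"
  define s where "s z = (\<Sum>n. complex_of_real (a (Suc n)) / of_nat (Suc n) * z ^ Suc n)" for z
  have s: "s has_fps_expansion ?A"
  proof (rule has_fps_expansionI)
    have "eventually (\<lambda>u. u \<in> ball (0::complex) 1) (nhds 0)"
      by (intro eventually_nhds_in_open) auto
    then show "eventually (\<lambda>u. (\<lambda>n. fps_nth ?A n * u ^ n) sums s u) (nhds 0)"
    proof eventually_elim
      case (elim u)
      then have "(\<lambda>n. complex_of_real (a (Suc n)) / of_nat (Suc n) * u ^ Suc n) sums s u"
        unfolding s_def using exponent_summable[OF a1 decr pos] by (intro summable_sums) auto
      then have "(\<lambda>n. fps_nth ?A (Suc n) * u ^ Suc n) sums s u"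
        by (simp add: exponent_fps_def)
      \<comment> \<open>Including index 0 changes nothing, as that coefficient is 0.\<close>
      then show ?case
        by (subst (asm) sums_Suc_iff) simp
    qed
  qed
  have "(exp \<circ> s) has_fps_expansion (fps_exp 1 oo ?A)"
    by (intro has_fps_expansion_compose has_fps_expansion_exp1 s) simp
  then have "(\<lambda>z. 1 - (1 - z) * (exp \<circ> s) z) has_fps_expansion
      (1 - (1 - fps_X) * (fps_exp 1 oo ?A))"
    by (intro has_fps_expansion_diff has_fps_expansion_mult has_fps_expansion_1
        has_fps_expansion_fps_X)
  then have "F a has_fps_expansion (1 - (1 - fps_X) * (fps_exp 1 oo ?A))"
    by (simp add: F_def[abs_def] s_def)
  then have "c a n = fps_nth (1 - (1 - fps_X) * (fps_exp 1 oo ?A)) n"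
    unfolding c_def by (simp only: fps_expansion_eqI)
  also have "\<dots> = of_real (- fps_nth (H_fps a) n)"
    using assms fps_exp_compose_of_real[OF exponent_fps_nth_0, of a]
    by (simp add: H_fps_def algebra_simps)
  finally show ?thesis .
qed

end

section \<open>Estimates on the closed disk\<close>

text \<open>Inside the disk \<open>q * norm z < q\<close> suffices. On the circle, equality in the
  triangle inequality would force \<open>q * z\<close> to point in the direction of
  \<open>p\<close>, so \<open>z = 1\<close>.\<close>

lemma norm_add_mult_less:
  fixes z :: complex
  assumes "p > 0" "q > 0" "norm z \<le> 1" "z \<noteq> 1"
  shows "norm (of_real p + of_real q * z) < p + q"
proof -
  have le: "norm (of_real p + of_real q * z) \<le> p + q * norm z"
    using norm_triangle_ineq[of "of_real p" "of_real q * z"] assms by (simp add: norm_mult)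
  show ?thesis
  proof (cases "norm z < 1")
    case True
    then have "q * norm z < q" using assms by simp
    with le show ?thesis by simp
  next
    case False
    then have z: "norm z = 1" using assms by simp
    have "norm (of_real p + of_real q * z) \<noteq> p + q"
    proof
      assume "norm (of_real p + of_real q * z) = p + q"
      then have "norm (complex_of_real p + of_real q * z) =
          norm (complex_of_real p) + norm (of_real q * z)"
        using assms z by (simp add: norm_mult)
      then have "p *\<^sub>R (of_real q * z) = q *\<^sub>R complex_of_real p"
        unfolding norm_triangle_eq using assms z by (simp add: norm_mult)
      then show False using assms by (simp add: scaleR_conv_of_real)
    qed
    with le z show ?thesis by simp
  qed
qed

text \<open>Weierstrass M-test: on the closed disk each term is bounded by the norm of its
  coefficient.\<close>

lemma continuous_on_power_series_cball:
  fixes q :: "nat \<Rightarrow> complex"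
  assumes "summable (\<lambda>n. norm (q n))"
  shows "continuous_on (cball 0 1) (\<lambda>z. \<Sum>n. q n * z ^ Suc n)"
proof (rule uniform_limit_theorem)
  show "uniform_limit (cball 0 1) (\<lambda>N z. \<Sum>n<N. q n * z ^ Suc n) (\<lambda>z. \<Sum>n. q n * z ^ Suc n)
      sequentially"
    using assms by (rule Weierstrass_m_test[rotated])
      (auto simp: norm_mult norm_power simp del: power_Suc intro!: mult_left_le power_le_one)
qed (auto intro!: always_eventually continuous_intros)

text \<open>The first two nonzero terms are bounded strictly by \<open>norm_add_mult_less\<close>
  after \<open>z ^ Suc m\<close> is factored out; the tail needs only the weak bound
  \<open>f_le\<close>.\<close>

lemma norm_power_series_less:
  fixes q :: "nat \<Rightarrow> real" and z :: complex
  assumes nonneg: "\<And>n. q n \<ge> 0" and q: "summable q" "suminf q \<le> 1"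
    and zero: "\<And>n. n < m \<Longrightarrow> q n = 0" and pos: "q m > 0" "q (Suc m) > 0"
    and z: "norm z \<le> 1" "z \<noteq> 0" "z \<noteq> 1"
  shows "norm (\<Sum>n. complex_of_real (q n) * z ^ Suc n) < norm z ^ Suc m"
proof -
  define f where "f n = complex_of_real (q n) * z ^ Suc n" for n
  have f_le: "norm (f (n + (m + 2))) \<le> norm z ^ Suc m * q (n + (m + 2))" for n
  proof -
    have "norm z ^ Suc (n + (m + 2)) \<le> norm z ^ Suc m"
      using z by (intro power_decreasing) auto
    from mult_left_mono[OF this nonneg[of "n + (m + 2)"]] show ?thesis
      by (simp add: f_def norm_mult norm_power nonneg mult.commute del: power_Suc)
  qed
  have tail: "summable (\<lambda>n. q (n + (m + 2)))"
    using q(1) by (rule summable_ignore_initial_segment)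
  have "summable (\<lambda>n. f (n + (m + 2)))"
    using summable_mult[OF tail] f_le by (rule summable_comparison_test')
  then have "summable f" by (simp only: summable_iff_shift)
  then have "suminf f = (\<Sum>n. f (n + (m + 2))) + (\<Sum>n<m + 2. f n)"
    by (rule suminf_split_initial_segment)
  also have "(\<Sum>n<m + 2. f n) = f m + f (Suc m)"
    using zero by (simp add: f_def)
  also have "\<dots> = z ^ Suc m * (of_real (q m) + of_real (q (Suc m)) * z)"
    by (simp add: f_def algebra_simps)
  finally have "norm (suminf f) \<le> norm (\<Sum>n. f (n + (m + 2))) +
      norm (z ^ Suc m * (of_real (q m) + of_real (q (Suc m)) * z))"
    using norm_triangle_ineq by metis
  moreover have "norm (\<Sum>n. f (n + (m + 2))) \<le> norm z ^ Suc m * (\<Sum>n. q (n + (m + 2)))"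
    using norm_suminf_le[OF f_le summable_mult[OF tail]] suminf_mult[OF tail] by simp
  moreover have "norm (z ^ Suc m * (of_real (q m) + of_real (q (Suc m)) * z)) <
      norm z ^ Suc m * (q m + q (Suc m))"
    unfolding norm_mult norm_power
    using norm_add_mult_less[OF pos z(1,3)] z by (intro mult_strict_left_mono) auto
  moreover have "norm z ^ Suc m * (\<Sum>n. q (n + (m + 2))) + norm z ^ Suc m * (q m + q (Suc m)) =
      norm z ^ Suc m * suminf q"
    using suminf_split_initial_segment[OF q(1), of "m + 2"] zero by (simp add: algebra_simps)
  moreover have "norm z ^ Suc m * suminf q \<le> norm z ^ Suc m"
    using q(2) by (intro mult_left_le) auto
  ultimately show ?thesis unfolding f_def by linarith
qed

theorem theorem2p1:
  fixes a :: "nat \<Rightarrow> real" and l :: nat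
  assumes pos: "\<And>n. n \<ge> 1 \<Longrightarrow> a n > 0"
    and decr: "\<And>n. n \<ge> 1 \<Longrightarrow> a (Suc n) \<le> a n"
    and a1: "a 1 = 1"
    and nonconst: "\<not> a constant_on {1..}"
    and l: "l = first_below_one a"
  shows
    "((\<forall>n\<ge>1. c a n \<in> complex_of_real ` {0..<1}) \<and>
      (\<exists>s. s \<le> 1 \<and> (\<lambda>n. c a (Suc n)) sums complex_of_real s)) \<and>
     (\<exists>G :: complex \<Rightarrow> complex. continuous_on (cball 0 1) G \<and> (\<forall>z\<in>ball 0 1. G z = F a z)) \<and>
     ((\<forall>n. 1 \<le> n \<and> n < l \<longrightarrow> c a n = 0) \<and>
      (\<forall>n\<ge>l. c a n \<in> complex_of_real ` {0<..})) \<and>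
     (\<forall>G :: complex \<Rightarrow> complex. continuous_on (cball 0 1) G \<and> (\<forall>z\<in>ball 0 1. G z = F a z) \<longrightarrow>
       (\<forall>z\<in>cball 0 1 - {0, 1}. norm (G z) < norm z ^ l))"
proof -
  \<comment> \<open>Shifted index: \<open>q n\<close> belongs to \<open>z ^ Suc n\<close>, so the
    first nonzero one has index \<open>m = l - 1\<close>.\<close>
  define q where "q n = - fps_nth (H_fps a) (Suc n)" for n
  note l_props = first_below_one_props[OF a1 decr pos nonconst, folded l]
  have c_q: "c a (Suc n) = of_real (q n)" for n
    unfolding q_def using a1 decr pos by (rule c_eq_H_fps) simp_all
  have nonneg: "q n \<ge> 0" for n
    using H_fps_nth_bounds(3)[OF a1 decr pos] by (simp add: q_def)
  have sum_less: "(\<Sum>k\<le>n. q k) < 1" for n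
    using sum_H_fps_nth_Suc_less[OF a1 decr pos] by (simp add: q_def)
  have less_1: "q n < 1" for n
    using sum_less[of n] member_le_sum[of n "{..n}" q] nonneg by simp
  have zero: "q n = 0" if "Suc n < l" for n
    using H_fps_nth_eq_0[OF a1 decr pos] that by (simp add: q_def l)
  have positive: "q n > 0" if "l \<le> Suc n" for n
    using H_fps_nth_neg[OF a1 decr pos nonconst] that by (simp add: q_def l)
  have summ: "summable q"
    using nonneg sum_less by (intro bounded_imp_summable[of q 1]) (auto simp: less_imp_le)
  have suminf_q: "suminf q \<le> 1"
    using summable_LIMSEQ'[OF summ] sum_less by (intro LIMSEQ_le_const2) (auto simp: less_imp_le)
  obtain m where m: "l = Suc m" using l_props(1) by (cases l) auto

  have range: "\<forall>n\<ge>1. c a n \<in> complex_of_real ` {0..<1}"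
  proof (intro allI impI)
    fix n :: nat assume "n \<ge> 1"
    then show "c a n \<in> complex_of_real ` {0..<1}"
      using c_q[of "n - 1"] nonneg less_1 by auto
  qed
  have "(\<lambda>n. c a (Suc n)) sums complex_of_real (suminf q)"
    unfolding c_q using summ by (intro sums_of_real summable_sums)
  with suminf_q have sum_c: "\<exists>s. s \<le> 1 \<and> (\<lambda>n. c a (Suc n)) sums complex_of_real s"
    by blast

  define P where "P z = (\<Sum>n. complex_of_real (q n) * z ^ Suc n)" for z
  have P_cont: "continuous_on (cball 0 1) P"
    unfolding P_def[abs_def] using summ nonneg
    by (intro continuous_on_power_series_cball) simp
  have P_F: "P z = F a z" if "z \<in> ball 0 1" for z
    using F_power_series[OF a1 decr pos, of z] that
    unfolding P_def c_q by (auto simp: sums_iff)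

  have c_zero: "\<forall>n. 1 \<le> n \<and> n < l \<longrightarrow> c a n = 0"
  proof (intro allI impI)
    fix n :: nat assume "1 \<le> n \<and> n < l"
    then show "c a n = 0"
      using c_q[of "n - 1"] zero[of "n - 1"] by simp
  qed
  have c_pos: "\<forall>n\<ge>l. c a n \<in> complex_of_real ` {0<..}"
  proof (intro allI impI)
    fix n :: nat assume "n \<ge> l"
    then show "c a n \<in> complex_of_real ` {0<..}"
      using c_q[of "n - 1"] positive[of "n - 1"] l_props(1) by auto
  qed

  have "norm (G z) < norm z ^ l"
    if G: "continuous_on (cball 0 1) G" "\<forall>z\<in>ball 0 1. G z = F a z" and z: "z \<in> cball 0 1 - {0, 1}"
    for G z
  proof -
    \<comment> \<open>The open disk is dense in the closed one, so any continuous extension of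
      \<open>F a\<close> coincides with \<open>P\<close>.\<close>
    have "G z - P z = 0"
    proof (rule continuous_constant_on_closure[where S = "ball 0 1" and f = "\<lambda>z. G z - P z"])
      show "continuous_on (closure (ball 0 1)) (\<lambda>z. G z - P z)"
        using G(1) P_cont by (simp add: continuous_on_diff)
    qed (use G(2) P_F z in auto)
    moreover have "norm (P z) < norm z ^ Suc m"
      unfolding P_def
      using z by (intro norm_power_series_less nonneg summ suminf_q zero positive) (auto simp: m)
    ultimately show ?thesis by (simp add: m)
  qed
  with range sum_c P_cont P_F c_zero c_pos show ?thesis by blast
qed

end
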